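(* There is no cube-free Descartes number with exactly seven distinct prime factors. That is, there do not exist an odd positive integer $n$ and positive integers $k, m$ such that $n = km$, $\sigma(k)(m+1) = 2km$, $p^3 \nmid n$ for every prime $p$, and $n$ has exactly seven distinct prime divisors.
   Context: $\sigma(k)$ denotes the sum of the positive divisors of $k$. An odd positive integer $n$ is called a Descartes number if there exist positive integers $k, m$ such that $n = km$ and $\sigma(k)(m+1) = 2km$. A Descartes number $n$ is called cube-free if there is no prime $p$ with $p^3 \mid n$. *)

theory Defs
  imports "HOL-Number_Theory.Number_Theory"
begin

definition sigma :: "nat \<Rightarrow> nat" where
  "sigma k = (\<Sum>d | d dvd k. d)"

definition descartes_number :: "nat \<Rightarrow> bool" where
  "descartes_number n \<longleftrightarrow>
     odd n \<and> (\<exists>k m. k > 0 \<and> m > 0 \<and> n = k * m \<and> sigma k * (m + 1) = 2 * k * m)"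

definition cube_free :: "nat \<Rightarrow> bool" where
  "cube_free n \<longleftrightarrow> \<not> (\<exists>p. prime p \<and> p ^ 3 dvd n)"

end

(*
  Write sigma(k) = m t, so t (m + 1) = 2 k. By parity and cube-freeness k is the square of a
  squarefree number and is coprime to m. Primes dividing some p^2 + p + 1 are 3 or 1 mod 3, so
  comparing residues and powers of 3 gives 3 | k and exactly two primes q1, q2 = 1 mod 3 in k,
  and with t = 9 u the equation becomes
    u (m + 1) = 2 (q1 q2)^2 prod r^2,  9 u m = 13 sigma(q1^2) sigma(q2^2) prod sigma(r^2),
  the r being the primes = 2 mod 3 in k, where u | (q1 q2)^2. Hence the product of
  1 + 1/p + 1/p^2 over q1, q2 and the r is (18/13) (1 - 1/(m + 1)) with m + 1 >= 2 prod r^2.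
  There are s <= 3 primes r, leaving 4 - s primes for m. The case s = 0 fails by size; for s = 1
  size leaves only the six-prime Descartes number with k = (3 7 11 13)^2; for s = 3 counting prime
  factors of u m makes 13 one of the r^2 + r + 1; for s = 2 the narrow window for the product leaves
  {5, 11}, excluded because it forces the primes 7, 13, 19, 31, and finitely many smallest three
  primes, none of which admits a fourth one.
*)

theory Submission
  imports Defs
begin

subsection \<open>The divisor sum\<close>

lemma sigma_mult_coprime:
  assumes "coprime a b"
  shows "sigma (a * b) = sigma a * sigma b"
proof (cases "a = 0 \<or> b = 0")
  case True
  have "sigma 0 = 0"
    unfolding sigma_def using infinite_UNIV_nat by simp
  with True show ?thesis by auto
next
  case False
  have inj: "inj_on (\<lambda>(d, e). d * e) ({d. d dvd a} \<times> {e. e dvd b})"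
  proof (rule inj_onI, clarsimp)
    fix d e d' e'
    assume dvd: "d dvd a" "e dvd b" "d' dvd a" "e' dvd b" and eq: "d * e = d' * e'"
    have "coprime d e'" "coprime d' e"
      using dvd assms by (meson coprime_divisors)+
    then have "d dvd d'" "d' dvd d"
      by (metis eq coprime_dvd_mult_left_iff dvd_triv_left)+
    then have "d = d'" by (rule dvd_antisym)
    moreover have "d \<noteq> 0" using dvd False by auto
    ultimately show "d = d' \<and> e = e'" using eq by auto
  qed
  have img: "{x. x dvd a * b} = (\<lambda>(d, e). d * e) ` ({d. d dvd a} \<times> {e. e dvd b})"
  proof (intro equalityI subsetI)
    fix x assume "x \<in> {x. x dvd a * b}"
    then obtain d e where "x = d * e" "d dvd a" "e dvd b"
      by (auto elim: dvd_productE)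
    then show "x \<in> (\<lambda>(d, e). d * e) ` ({d. d dvd a} \<times> {e. e dvd b})" by auto
  qed (auto intro: mult_dvd_mono)
  show ?thesis
    unfolding sigma_def img sum.reindex[OF inj]
    by (simp add: sum_product sum.cartesian_product case_prod_unfold)
qed

lemma sigma_prime:
  assumes "prime p"
  shows "sigma p = p + 1"
proof -
  have "{d. d dvd p} = {1, p}" using assms by (auto simp: prime_nat_iff)
  then have "sigma p = (\<Sum>d\<in>{1, p}. d)" by (simp only: sigma_def)
  also have "\<dots> = p + 1" using prime_gt_1_nat[OF assms] by simp
  finally show ?thesis .
qed

definition sigma_sq :: "nat \<Rightarrow> nat" where
  "sigma_sq p = p\<^sup>2 + p + 1"

lemma sigma_prime_square:
  assumes "prime p"
  shows "sigma (p\<^sup>2) = sigma_sq p"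
proof -
  have gt: "p > 1" using assms by (rule prime_gt_1_nat)
  have "{d. d dvd p\<^sup>2} = (\<lambda>i. p ^ i) ` {..2}"
    using divides_primepow_nat[OF assms] by auto
  also have "\<dots> = {1, p, p\<^sup>2}"
    by (auto simp: atMost_Suc numeral_2_eq_2)
  finally show ?thesis
    using gt by (simp add: sigma_def sigma_sq_def power2_eq_square)
qed

lemma sigma_prod_squares:
  assumes "finite P" "\<And>p. p \<in> P \<Longrightarrow> prime p"
  shows "sigma (\<Prod>p\<in>P. p\<^sup>2) = (\<Prod>p\<in>P. sigma_sq p)"
  using assms
proof (induction P rule: finite_induct)
  case empty
  have "{d::nat. d dvd 1} = {1}" by auto
  then show ?case by (simp add: sigma_def)
next
  case (insert x F)
  have "coprime (x\<^sup>2) (\<Prod>p\<in>F. p\<^sup>2)"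
    using insert by (intro prod_coprime_right) (auto intro: primes_coprime)
  with insert show ?case by (simp add: sigma_mult_coprime sigma_prime_square)
qed

text \<open>A prime \<open>p\<close> dividing \<open>k\<close> exactly once would put the even
  factor \<open>p + 1\<close> into \<open>sigma k\<close>; cube-freeness then leaves only the
  exponent 2.\<close>

lemma cube_free_odd_sigma:
  assumes "odd k" "cube_free k" "odd (sigma k)"
  shows "k = (\<Prod>p\<in>prime_factors k. p\<^sup>2)"
proof -
  have k0: "k \<noteq> 0" using assms(1) by (intro notI) simp
  have "multiplicity p k = 2" if p: "p \<in> prime_factors k" for p
  proof -
    have pr: "prime p" "p dvd k" using p by (auto simp: in_prime_factors_iff)
    have "\<not> p ^ 3 dvd k" using assms(2) pr by (auto simp: cube_free_def)
    then have "multiplicity p k < 3"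
      using multiplicity_dvd'[of 3 p k] by linarith
    moreover have "multiplicity p k \<noteq> 0"
      using pr k0 by (subst multiplicity_eq_zero_iff) auto
    moreover have "multiplicity p k \<noteq> 1"
    proof
      assume 1: "multiplicity p k = 1"
      have "\<not> is_unit p" using pr by auto
      then obtain y where y: "k = p ^ 1 * y" "\<not> p dvd y"
        using multiplicity_decompose'[of k p] k0 1 by auto
      then have "sigma k = (p + 1) * sigma y"
        using pr by (simp add: sigma_mult_coprime sigma_prime prime_imp_coprime)
      moreover have "odd p" using pr assms(1) by auto
      ultimately show False using assms(3) by simp
    qed
    ultimately show ?thesis by linarith
  qed
  then show ?thesis
    using prime_factorization_nat[of k] k0 by simp
qed

subsection \<open>Residues modulo 3\<close>

text \<open>As \<open>l\<close> divides \<open>p ^ 3 - 1\<close>, the order of \<open>p\<close>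
  modulo \<open>l\<close> divides both 3 and \<open>l - 1\<close>. For \<open>l mod 3 = 2\<close> it
  is therefore 1, so \<open>sigma_sq p\<close> is congruent to 3 modulo \<open>l\<close>, and
  \<open>l\<close> divides 3.\<close>

lemma prime_dvd_sigma_sq:
  assumes l: "prime l" "l dvd sigma_sq p"
  shows "l = 3 \<or> l mod 3 = 1"
proof (rule ccontr)
  assume H: "\<not> ?thesis"
  have prime3: "prime (3::nat)" by simp
  have cube: "(p - 1) * sigma_sq p + 1 = p ^ 3" if "p > 0"
    using that by (cases p) (auto simp: sigma_sq_def power2_eq_square power3_eq_cube algebra_simps)
  have ndvd: "\<not> l dvd p"
  proof
    assume "l dvd p"
    then have "l dvd p\<^sup>2 + p" by (simp add: power2_eq_square)
    then have "l dvd 1" using l(2) unfolding sigma_sq_def by (metis dvd_add_right_iff)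
    with l(1) show False by auto
  qed
  then have p0: "p > 0" by (cases p) auto
  have "[p ^ 3 = 1] (mod l)"
  proof -
    have "[(p - 1) * sigma_sq p + 1 = 0 + 1] (mod l)"
      using l(2) by (intro cong_add) (auto simp: cong_0_iff)
    then show ?thesis using cube[OF p0] by simp
  qed
  then have o3: "ord l p dvd 3" using ord_divides by blast
  have "coprime p l" using ndvd l(1) by (metis coprime_commute prime_imp_coprime)
  then have "[p ^ (l - 1) = 1] (mod l)"
    using l(1) ndvd fermat_theorem by blast
  then have ol: "ord l p dvd l - 1" using ord_divides by blast
  have "l mod 3 \<noteq> 0"
    using H l(1) by (metis dvd_eq_mod_eq_0 primes_dvd_imp_eq prime3)
  then have "l mod 3 = 2" using H by linarith
  then have "\<not> 3 dvd l - 1"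
    using prime_gt_1_nat[OF l(1)] by presburger
  moreover have "ord l p = 1 \<or> ord l p = 3"
    using o3 prime3 by (auto simp: prime_nat_iff)
  ultimately have "ord l p = 1" using ol by auto
  then have "[p = 1] (mod l)"
    using ord_divides[of p 1 l] by simp
  then have "[p\<^sup>2 + p + 1 = 1\<^sup>2 + 1 + 1] (mod l)"
    by (intro cong_add cong_pow) auto
  then have "[0 = 3] (mod l)"
    using l(2) unfolding sigma_sq_def cong_def by (simp add: numeral_3_eq_3 del: One_nat_def)
  then have "l dvd 3" by (metis cong_0_iff cong_sym)
  with l(1) H show False
    by (metis primes_dvd_imp_eq prime3)
qed

lemma sigma_sq_mod3: "p mod 3 = 2 \<Longrightarrow> sigma_sq p mod 3 = 1"
proof -
  assume "p mod 3 = 2"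
  then obtain j where "p = 3 * j + 2" by (metis mult_div_mod_eq)
  then have "sigma_sq p = 3 * (3 * (j * j) + 5 * j + 2) + 1"
    by (simp add: sigma_sq_def power2_eq_square algebra_simps)
  then show ?thesis by presburger
qed

text \<open>Each prime = 1 mod 3 in \<open>k\<close> thus contributes exactly one factor 3 to the
  divisor sum; this is how such primes are counted later.\<close>

lemma sigma_sq_one_mod3:
  assumes "p mod 3 = 1"
  shows "3 dvd sigma_sq p" "\<not> 9 dvd sigma_sq p"
proof -
  obtain j where j: "p = 3 * j + 1" using assms by (metis mult_div_mod_eq)
  have "sigma_sq p = 9 * (j * j + j) + 3"
    by (simp add: j sigma_sq_def power2_eq_square algebra_simps)
  then show "3 dvd sigma_sq p" "\<not> 9 dvd sigma_sq p" by presburger+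
qed

lemma mod3_eq_1_if_prime_factors:
  fixes x :: nat
  assumes "x > 0" "\<And>p. prime p \<Longrightarrow> p dvd x \<Longrightarrow> p mod 3 = 1"
  shows "x mod 3 = 1"
proof -
  have "[(\<Prod>p\<in>prime_factors x. p ^ multiplicity p x) = (\<Prod>p\<in>prime_factors x. 1)] (mod 3)"
  proof (rule cong_prod)
    fix p assume "p \<in> prime_factors x"
    then have "p mod 3 = 1" by (intro assms(2)) (auto simp: in_prime_factors_iff)
    then have "[p = 1] (mod 3)" by (simp add: cong_def)
    from cong_pow[OF this, of "multiplicity p x"]
    show "[p ^ multiplicity p x = 1] (mod 3)" by simp
  qed
  then show ?thesis using prime_factorization_nat[of x] assms(1) by (simp add: cong_def)
qed

subsection \<open>The abundancy of a square of a prime\<close>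

definition abund :: "nat \<Rightarrow> real" where
  "abund p = sigma_sq p / (real p)\<^sup>2"

lemma abund_eq: "p > 0 \<Longrightarrow> abund p = 1 + 1 / p + 1 / (real p)\<^sup>2"
  by (simp add: abund_def sigma_sq_def field_simps power2_eq_square)

lemma abund_nonneg: "0 \<le> abund p"
  by (simp add: abund_def)

lemma abund_ge_1: "p > 0 \<Longrightarrow> abund p \<ge> 1"
  by (simp add: abund_eq)

lemma abund_antimono:
  assumes "0 < p" "p \<le> q"
  shows "abund q \<le> abund p"
proof -
  have "1 / real q \<le> 1 / real p" using assms by (simp add: frac_le)
  moreover have "1 / (real q)\<^sup>2 \<le> 1 / (real p)\<^sup>2" using assms by (intro frac_le power_mono) auto
  ultimately show ?thesis using assms by (simp add: abund_eq)
qed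

section \<open>Numerical tests for the third and the fourth prime\<close>

text \<open>Given \<open>a < b < c\<close>, the product of the four abundancies leaves for the fourth prime only a window
  that lies strictly between two consecutive members \<open>x < x + 6\<close> of its residue class modulo 6.\<close>

definition no_fourth :: "nat \<Rightarrow> nat \<Rightarrow> nat \<Rightarrow> bool" where
  "no_fourth a b c \<longleftrightarrow>
    (let A = 13 * (sigma_sq a * sigma_sq b * sigma_sq c);
         B = 18 * (a * b * c)\<^sup>2;
         rs = filter (\<lambda>p. p mod 3 = 2) [a, b, c];
         r = prod_list rs;
         \<rho> = (if length rs = 1 then 5 else 1);
         e = A div (B - A) + 1;
         x = e - (e + 6 - \<rho>) mod 6;
         y = x + 6;
         s = (if length rs = 1 then r * y else r)
     in B \<le> A \<or> length rs \<notin> {1, 2} \<or>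
        (0 < x \<and> x mod 6 = \<rho> \<and> 0 < s \<and> (x \<le> c \<or> B * x\<^sup>2 \<le> A * sigma_sq x) \<and>
         A * sigma_sq y * (2 * s\<^sup>2) < B * y\<^sup>2 * (2 * s\<^sup>2 - 1)))"

text \<open>\<open>A / B\<close> is 13/18 of the product of the two abundancies, and 2450 = 2 *
  35^2, where 35 bounds the product of the two primes = 2 mod 3 from below. If
  \<open>B \<le> A\<close>, two abundancies already reach 18/13; otherwise two further primes, both
  at least \<open>n\<close>, would leave the product of all four below its lower bound.\<close>

definition third_lt :: "nat \<Rightarrow> nat \<Rightarrow> nat \<Rightarrow> bool" where
  "third_lt n a b \<longleftrightarrow>
    (let A = 13 * (sigma_sq a * sigma_sq b); B = 18 * (a * b)\<^sup>2
     in B \<le> A \<or> A * (sigma_sq n)\<^sup>2 * 2450 < B * n ^ 4 * 2449)"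

text \<open>For 5 and 7 the first alternative of the test applies, since 31/25 * 57/49 exceeds
  18/13. Here and in the following tables the list holds all primes strictly between the second
  prime and the bound on the third.\<close>

lemma third_fourth_5_7: "third_lt 11 5 7" "\<forall>c\<in>set []. no_fourth 5 7 c"
  \<comment> \<open>\<open>let_weak_cong\<close> has each bound value computed before
    \<open>Let_def\<close> substitutes it.\<close>
  by (simp_all only: list.set ball_simps(5,7) simp_thms)
     (simp_all add: no_fourth_def third_lt_def sigma_sq_def Let_def cong: let_weak_cong)

lemma third_fourth_5_13: "third_lt 67 5 13" "\<forall>c\<in>set [17, 19, 23, 29, 31, 37, 41, 43, 47, 53, 59, 61]. no_fourth 5 13 c"
  by (simp_all only: list.set ball_simps(5,7) simp_thms)
     (simp_all add: no_fourth_def third_lt_def sigma_sq_def Let_def cong: let_weak_cong)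

lemma third_fourth_5_17: "third_lt 41 5 17" "\<forall>c\<in>set [19, 23, 29, 31, 37]. no_fourth 5 17 c"
  by (simp_all only: list.set ball_simps(5,7) simp_thms)
     (simp_all add: no_fourth_def third_lt_def sigma_sq_def Let_def cong: let_weak_cong)

lemma third_fourth_5_19: "third_lt 37 5 19" "\<forall>c\<in>set [23, 29, 31]. no_fourth 5 19 c"
  by (simp_all only: list.set ball_simps(5,7) simp_thms)
     (simp_all add: no_fourth_def third_lt_def sigma_sq_def Let_def cong: let_weak_cong)

lemma third_fourth_5_23: "third_lt 31 5 23" "\<forall>c\<in>set [29]. no_fourth 5 23 c"
  by (simp_all only: list.set ball_simps(5,7) simp_thms)
     (simp_all add: no_fourth_def third_lt_def sigma_sq_def Let_def cong: let_weak_cong)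

lemma third_fourth_7_11: "third_lt 29 7 11" "\<forall>c\<in>set [13, 17, 19, 23]. no_fourth 7 11 c"
  by (simp_all only: list.set ball_simps(5,7) simp_thms)
     (simp_all add: no_fourth_def third_lt_def sigma_sq_def Let_def cong: let_weak_cong)

lemma third_fourth_7_13: "third_lt 23 7 13" "\<forall>c\<in>set [17, 19]. no_fourth 7 13 c"
  by (simp_all only: list.set ball_simps(5,7) simp_thms)
     (simp_all add: no_fourth_def third_lt_def sigma_sq_def Let_def cong: let_weak_cong)

lemma third_fourth_7_17: "third_lt 19 7 17" "\<forall>c\<in>set []. no_fourth 7 17 c"
  by (simp_all only: list.set ball_simps(5,7) simp_thms)
     (simp_all add: no_fourth_def third_lt_def sigma_sq_def Let_def cong: let_weak_cong)

lemma third_fourth_7_19: "third_lt 23 7 19" "\<forall>c\<in>set []. no_fourth 7 19 c"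
  by (simp_all only: list.set ball_simps(5,7) simp_thms)
     (simp_all add: no_fourth_def third_lt_def sigma_sq_def Let_def cong: let_weak_cong)

lemma third_fourth_7_23: "third_lt 29 7 23" "\<forall>c\<in>set []. no_fourth 7 23 c"
  by (simp_all only: list.set ball_simps(5,7) simp_thms)
     (simp_all add: no_fourth_def third_lt_def sigma_sq_def Let_def cong: let_weak_cong)

section \<open>From the numerical tests to contradictions\<close>

lemma mod_6_gap:
  assumes "k \<le> l" "l mod 6 = k mod 6"
  shows "l = k \<or> k + 6 \<le> (l::nat)"
proof -
  have "6 dvd l - k" using assms mod_eq_dvd_iff_nat by blast
  then show ?thesis using assms(1) dvd_imp_le[of 6 "l - k"] by linarith
qed

text \<open>Lets the product of the primes = 2 mod 3 be replaced by any positive lower bound for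
  it.\<close>

lemma lower_bound_mono:
  fixes R R' F :: real
  assumes "0 < R" "R \<le> R'" "18 / 13 * (1 - 1 / (2 * R'\<^sup>2)) \<le> F"
  shows "18 / 13 * (1 - 1 / (2 * R\<^sup>2)) \<le> F"
proof -
  have "R\<^sup>2 \<le> R'\<^sup>2" using assms by (intro power_mono) auto
  then have "1 / (2 * R'\<^sup>2) \<le> 1 / (2 * R\<^sup>2)" using assms by (intro frac_le) auto
  with assms(3) show ?thesis by argo
qed

text \<open>The upper bound on the product pushes \<open>d\<close> above \<open>x\<close>, hence to
  at least \<open>x + 6\<close> in its class modulo 6, and there the product has already dropped
  below its lower bound.\<close>

lemma no_fourth_contradiction:
  fixes a b c d :: nat
  defines "rs \<equiv> filter (\<lambda>p. p mod 3 = 2) [a, b, c, d]"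
  assumes pos: "0 < a" "0 < b" "0 < c" and "c < d" "odd d" "\<not> 3 dvd d"
    and len: "length rs = 2"
    and up: "abund a * abund b * abund c * abund d < 18 / 13"
    and low: "18 / 13 * (1 - 1 / (2 * (real (prod_list rs))\<^sup>2)) \<le> abund a * abund b * abund c * abund d"
    and ok: "no_fourth a b c"
  shows False
proof -
  define K where "K = abund a * abund b * abund c"
  define A where "A = 13 * (sigma_sq a * sigma_sq b * sigma_sq c)"
  define B where "B = 18 * (a * b * c)\<^sup>2"
  define rs0 where "rs0 = filter (\<lambda>p. p mod 3 = 2) [a, b, c]"
  define r where "r = prod_list rs0"
  define \<rho> :: nat where "\<rho> = (if length rs0 = 1 then 5 else 1)"
  \<comment> \<open>The upper bound says d^2 / (d + 1) > A / (B - A), and equality holds at a real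
    number between A / (B - A) and A / (B - A) + 1. So \<open>x\<close> is meant as the last member
    of the class of \<open>\<rho>\<close> up to this threshold; the summand 6 keeps the subtraction
    of \<open>\<rho>\<close> from being cut off at 0.\<close>
  define x where "x = (A div (B - A) + 1) - (A div (B - A) + 1 + 6 - \<rho>) mod 6"
  define y where "y = x + 6"
  define s where "s = (if length rs0 = 1 then r * y else r)"
  have B0: "B > 0" using pos by (simp add: B_def)
  have K: "K = 18 / 13 * (real A / real B)"
    by (simp add: K_def A_def B_def abund_def power_mult_distrib)
  have K0: "K \<ge> 0" unfolding K by simp
  have rs: "rs = rs0 @ (if d mod 3 = 2 then [d] else [])"
    by (simp add: rs_def rs0_def)
  have d3: "d mod 3 = 1 \<or> d mod 3 = 2" using \<open>\<not> 3 dvd d\<close> by presburger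
  have up': "K * abund d < 18 / 13" using up by (simp add: K_def)
  have low': "18 / 13 * (1 - 1 / (2 * (real (prod_list rs))\<^sup>2)) \<le> K * abund d"
    using low by (simp add: K_def)
  have "K < 18 / 13"
    using up' mult_left_mono[OF abund_ge_1[of d] K0] \<open>c < d\<close> by simp
  then have "\<not> B \<le> A" using B0 unfolding K by (simp add: divide_less_eq)
  moreover have "length rs0 \<in> {1, 2}" using len rs by (auto split: if_splits)
  moreover have "B \<le> A \<or> length rs0 \<notin> {1, 2} \<or>
      (0 < x \<and> x mod 6 = \<rho> \<and> 0 < s \<and> (x \<le> c \<or> B * x\<^sup>2 \<le> A * sigma_sq x) \<and>
       A * sigma_sq y * (2 * s\<^sup>2) < B * y\<^sup>2 * (2 * s\<^sup>2 - 1))"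
    using ok
    by (simp only: no_fourth_def Let_def A_def B_def rs0_def r_def \<rho>_def x_def y_def s_def)
  ultimately have x: "0 < x" "x mod 6 = \<rho>" "0 < s" "x \<le> c \<or> B * x\<^sup>2 \<le> A * sigma_sq x"
    and y: "A * sigma_sq y * (2 * s\<^sup>2) < B * y\<^sup>2 * (2 * s\<^sup>2 - 1)"
    by blast+
  \<comment> \<open>Exactly two of the four primes are = 2 mod 3, so their number among
    \<open>a\<close>, \<open>b\<close>, \<open>c\<close> decides the residue of \<open>d\<close>
    modulo 3, and \<open>d\<close> is odd.\<close>
  have "d mod 6 = \<rho>"
    using len rs d3 \<open>odd d\<close> by (auto simp: \<rho>_def split: if_splits) presburger+
  have "x < d"
  proof (rule ccontr)
    assume "\<not> x < d"
    then have "real (B * x\<^sup>2) \<le> real (A * sigma_sq x)"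
      using x(4) \<open>c < d\<close> by (metis of_nat_le_iff less_le_trans not_less)
    then have "1 \<le> (real A / real B) * abund x"
      using B0 x(1) by (simp add: abund_def field_simps)
    then have "18 / 13 \<le> K * abund x" by (simp add: K)
    also have "\<dots> \<le> K * abund d"
      using \<open>\<not> x < d\<close> \<open>c < d\<close> K0 by (intro mult_left_mono abund_antimono) auto
    finally show False using up' by simp
  qed
  then have "y \<le> d"
    using mod_6_gap[of x d] \<open>d mod 6 = \<rho>\<close> x(2) unfolding y_def by simp
  \<comment> \<open>If \<open>d\<close> is one of the two primes = 2 mod 3, it contributes at least
    \<open>y\<close> to their product.\<close>
  have "s \<le> prod_list rs"
  proof (cases "length rs0 = 1")
    case True
    then have "rs = rs0 @ [d]" using len rs by (cases "d mod 3 = 2") simp_all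
    then show ?thesis using True \<open>y \<le> d\<close> by (simp add: s_def r_def)
  next
    case False
    then have "rs = rs0" using len rs by (cases "d mod 3 = 2") simp_all
    then show ?thesis using False by (simp add: s_def r_def)
  qed
  then have "18 / 13 * (1 - 1 / (2 * (real s)\<^sup>2)) \<le> K * abund d"
    using x(3) by (intro lower_bound_mono[OF _ _ low']) auto
  also have "\<dots> \<le> K * abund y"
    using \<open>y \<le> d\<close> K0 by (intro mult_left_mono abund_antimono) (auto simp: y_def)
  finally have *: "1 - 1 / (2 * (real s)\<^sup>2) \<le> (real A / real B) * abund y" by (simp add: K)
  have "real (A * sigma_sq y * (2 * s\<^sup>2)) < real (B * y\<^sup>2 * (2 * s\<^sup>2 - 1))"
    using y by (simp only: of_nat_less_iff)
  also have "\<dots> = real B * (real y)\<^sup>2 * (2 * (real s)\<^sup>2 - 1)"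
    using x(3) by (simp add: of_nat_diff)
  finally have "real A * sigma_sq y * (2 * (real s)\<^sup>2) < real B * (real y)\<^sup>2 * (2 * (real s)\<^sup>2 - 1)"
    by simp
  then have "(real A / real B) * abund y < 1 - 1 / (2 * (real s)\<^sup>2)"
    using B0 x(3) by (simp add: abund_def y_def field_simps)
  with * show False by simp
qed

text \<open>67 is the largest bound on the third prime in the tables.\<close>

definition primes_less_67 :: "nat list" where
  "primes_less_67 = [2, 3, 5, 7, 11, 13, 17, 19, 23, 29, 31, 37, 41, 43, 47, 53, 59, 61]"

text \<open>A composite number below 67 has a prime factor at most 7, so sieving by 2, 3, 5 and 7
  suffices.\<close>

lemma prime_less_67:
  assumes "prime (p::nat)" "p < 67"
  shows "p \<in> set primes_less_67"
proof -
  have small: "2 dvd p \<longrightarrow> p = 2" "3 dvd p \<longrightarrow> p = 3" "5 dvd p \<longrightarrow> p = 5" "7 dvd p \<longrightarrow> p = 7"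
    using primes_dvd_imp_eq[of 2 p] primes_dvd_imp_eq[of 3 p] primes_dvd_imp_eq[of 5 p]
      primes_dvd_imp_eq[of 7 p] assms(1) by auto
  have "p > 1" using assms(1) by (rule prime_gt_1_nat)
  have "p = 2 \<or> p = 3 \<or> (\<exists>k<12. p = 6 * k + 1 \<or> p = 6 * k + 5)"
    using small(1,2) assms(2) \<open>p > 1\<close> by presburger
  then consider "p = 2 \<or> p = 3" | k where "k < 12" "p = 6 * k + 1 \<or> p = 6 * k + 5" by blast
  then show ?thesis
  proof cases
    case (2 k)
    have "k \<in> {0, 1, 2, 3, 4, 5, 6, 7, 8, 9, 10, 11}"
      using 2(1) by (simp add: numeral_eq_Suc less_Suc_eq)
    then show ?thesis
      using 2(2) assms(2) small(3,4) \<open>p > 1\<close> by (elim insertE emptyE disjE) (simp_all add: primes_less_67_def)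
  qed (auto simp: primes_less_67_def)
qed

lemma prod4_abund_antimono:
  assumes "0 < a'" "0 < b'" "0 < c'" "0 < d'" "a' \<le> a" "b' \<le> b" "c' \<le> c" "d' \<le> d"
  shows "abund a * abund b * abund c * abund d \<le> abund a' * abund b' * abund c' * abund d'"
  by (intro mult_mono mult_nonneg_nonneg abund_nonneg abund_antimono assms)

text \<open>Either \<open>c\<close> is below \<open>n\<close>, hence in \<open>cs\<close>, and
  \<open>no_fourth\<close> applies, or \<open>c\<close> and \<open>d\<close> are both at least
  \<open>n\<close>, and \<open>third_lt\<close> contradicts the lower bound.\<close>

lemma third_fourth_contradiction:
  fixes a b c d :: nat
  defines "rs \<equiv> filter (\<lambda>p. p mod 3 = 2) [a, b, c, d]"
  assumes primes: "prime c" "prime d" and "5 \<le> a" "a < b" "b < c" "c < d"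
    and len: "length rs = 2" and large: "35 \<le> prod_list rs"
    and up: "abund a * abund b * abund c * abund d < 18 / 13"
    and low: "18 / 13 * (1 - 1 / (2 * (real (prod_list rs))\<^sup>2)) \<le> abund a * abund b * abund c * abund d"
    and third: "third_lt n a b" "0 < n" "n \<le> 67" and fourth: "\<forall>c\<in>set cs. no_fourth a b c"
    and cs: "\<forall>p\<in>set primes_less_67.
      b < p \<longrightarrow> p < n \<longrightarrow> p \<in> set cs"
  shows False
proof (cases "c < n")
  case True
  then have "no_fourth a b c"
    using fourth cs prime_less_67[OF primes(1)] \<open>b < c\<close> \<open>n \<le> 67\<close> by auto
  moreover have "odd d"
    using primes \<open>5 \<le> a\<close> \<open>a < b\<close> \<open>b < c\<close> \<open>c < d\<close> by (intro prime_odd_nat) auto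
  moreover have "\<not> 3 dvd d"
    using primes \<open>5 \<le> a\<close> \<open>a < b\<close> \<open>b < c\<close> \<open>c < d\<close> primes_dvd_imp_eq[of 3 d] by auto
  ultimately show False
    using no_fourth_contradiction[of a b c d] assms by auto
next
  case False
  define A where "A = 13 * (sigma_sq a * sigma_sq b)"
  define B where "B = 18 * (a * b)\<^sup>2"
  have B0: "B > 0" using assms by (simp add: B_def)
  have K: "abund a * abund b = 18 / 13 * (real A / real B)"
    by (simp add: A_def B_def abund_def power_mult_distrib)
  have K0: "abund a * abund b \<ge> 0" unfolding K by simp
  have "1 \<le> abund c" "1 \<le> abund d" using assms by (simp_all add: abund_ge_1)
  then have "1 \<le> abund c * abund d" using mult_mono[of 1 "abund c" 1 "abund d"] by simp
  from mult_left_mono[OF this K0]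
  have "abund a * abund b \<le> abund a * abund b * abund c * abund d" by (simp add: mult.assoc)
  then have "abund a * abund b < 18 / 13" using up by simp
  then have "\<not> B \<le> A" using B0 unfolding K by (simp add: divide_less_eq)
  then have less: "A * (sigma_sq n)\<^sup>2 * 2450 < B * n ^ 4 * 2449"
    using third(1) by (simp add: third_lt_def Let_def A_def B_def)
  have "18 / 13 * (1 - 1 / (2 * (35::real)\<^sup>2)) \<le> abund a * abund b * abund c * abund d"
    using large by (intro lower_bound_mono[OF _ _ low]) auto
  also have "\<dots> \<le> abund a * abund b * abund n * abund n"
    using assms False by (intro prod4_abund_antimono) auto
  finally have "2449 / 2450 \<le> (real A / real B) * (abund n)\<^sup>2"
    by (simp add: K power2_eq_square)
  moreover have "real (A * (sigma_sq n)\<^sup>2 * 2450) < real (B * n ^ 4 * 2449)"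
    using less by (simp only: of_nat_less_iff)
  then have "(real A / real B) * (abund n)\<^sup>2 < 2449 / 2450"
    using B0 third(2) by (simp add: abund_def field_simps power2_eq_square eval_nat_numeral)
  ultimately show False by simp
qed

text \<open>The lower bound forces \<open>a\<close> to be 5 or 7 and \<open>b\<close> to be below
  29. The tables settle every such pair except 5, 11, which is left to an arithmetic
  argument.\<close>

lemma no_four_primes:
  fixes a b c d :: nat
  defines "rs \<equiv> filter (\<lambda>p. p mod 3 = 2) [a, b, c, d]"
  assumes primes: "prime a" "prime b" "prime c" "prime d" and ord: "5 \<le> a" "a < b" "b < c" "c < d"
    and len: "length rs = 2"
    and up: "abund a * abund b * abund c * abund d < 18 / 13"
    and low: "18 / 13 * (1 - 1 / (2 * (real (prod_list rs))\<^sup>2)) \<le> abund a * abund b * abund c * abund d"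
    and not_5_11: "\<not> (a = 5 \<and> b = 11)"
  shows False
proof -
  \<comment> \<open>The two primes = 2 mod 3 are distinct and at least 5, so the larger is at least
    7; this is the source of the constant 35.\<close>
  obtain x y where xy: "rs = [x, y]"
    using len by (auto simp: length_Suc_conv numeral_2_eq_2)
  have "sorted_wrt (<) rs"
    unfolding rs_def by (intro sorted_wrt_filter) (use ord in auto)
  then have "x < y" by (simp add: xy)
  have "x \<in> set rs" "y \<in> set rs" by (simp_all add: xy)
  moreover have "set rs \<subseteq> {a, b, c, d}" by (auto simp: rs_def)
  ultimately have "x \<in> {a, b, c, d}" "y \<in> {a, b, c, d}" by blast+
  then have "5 \<le> x" "prime y" using ord primes by auto
  have "y \<noteq> 6" using \<open>prime y\<close> by auto
  then have "7 \<le> y" using \<open>5 \<le> x\<close> \<open>x < y\<close> by simp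
  then have large: "35 \<le> prod_list rs"
    using mult_le_mono[OF \<open>5 \<le> x\<close> \<open>7 \<le> y\<close>] by (simp add: xy)
  then have low': "18 / 13 * (1 - 1 / (2 * (35::real)\<^sup>2)) \<le> abund a * abund b * abund c * abund d"
    by (intro lower_bound_mono[OF _ _ low]) auto
  \<comment> \<open>Raises a lower bound \<open>k\<close> for a prime to \<open>l\<close> by
    inspecting the primes below 67.\<close>
  have next_prime: "\<forall>p\<in>set primes_less_67.
      k \<le> p \<longrightarrow> l \<le> p \<Longrightarrow> l \<le> 67 \<Longrightarrow> prime p \<Longrightarrow> k \<le> p \<Longrightarrow> l \<le> p" for k l p :: nat
    using prime_less_67[of p] by (cases "p < 67") auto
  have "a < 11"
  proof (rule ccontr)
    assume "\<not> a < 11"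
    moreover from this have "13 \<le> b" using ord primes by (intro next_prime[of 12 13 b]) (auto simp: primes_less_67_def)
    moreover from this have "17 \<le> c" using ord primes by (intro next_prime[of 14 17 c]) (auto simp: primes_less_67_def)
    moreover from this have "19 \<le> d" using ord primes by (intro next_prime[of 18 19 d]) (auto simp: primes_less_67_def)
    ultimately have "abund a * abund b * abund c * abund d
        \<le> abund 11 * abund 13 * abund 17 * abund 19"
      by (intro prod4_abund_antimono) auto
    also have "\<dots> < 18 / 13 * (1 - 1 / (2 * (35::real)\<^sup>2))"
      by (simp add: abund_def sigma_sq_def)
    finally show False using low' by simp
  qed
  then have a: "a = 5 \<or> a = 7" using prime_less_67[OF primes(1)] ord by (auto simp: primes_less_67_def)
  have "b < 29"
  proof (rule ccontr)
    assume "\<not> b < 29"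
    then have "abund a * abund b * abund c * abund d
        \<le> abund 5 * abund 29 * abund 29 * abund 29"
      using ord by (intro prod4_abund_antimono) auto
    also have "\<dots> < 18 / 13 * (1 - 1 / (2 * (35::real)\<^sup>2))"
      by (simp add: abund_def sigma_sq_def)
    finally show False using low' by simp
  qed
  then have "b \<in> set [7, 11, 13, 17, 19, 23]" using prime_less_67[OF primes(2)] ord by (auto simp: primes_less_67_def)
  with a ord not_5_11 consider
    "a = 5" "b = 7" | "a = 5" "b = 13" | "a = 5" "b = 17" | "a = 5" "b = 19" | "a = 5" "b = 23" |
    "a = 7" "b = 11" | "a = 7" "b = 13" | "a = 7" "b = 17" | "a = 7" "b = 19" | "a = 7" "b = 23"
    by auto
  note cases = this
  note contra = third_fourth_contradiction[OF primes(3,4) ord len[unfolded rs_def] large[unfolded rs_def]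
      up low[unfolded rs_def]]
  show False
    using cases
  proof cases
    case 1
    show ?thesis
      by (rule contra[of 11 "[]"]) (use 1 third_fourth_5_7 in \<open>simp_all add: primes_less_67_def\<close>)
  next
    case 2
    show ?thesis
      by (rule contra[of 67 "[17, 19, 23, 29, 31, 37, 41, 43, 47, 53, 59, 61]"]) (use 2 third_fourth_5_13 in \<open>simp_all add: primes_less_67_def\<close>)
  next
    case 3
    show ?thesis
      by (rule contra[of 41 "[19, 23, 29, 31, 37]"]) (use 3 third_fourth_5_17 in \<open>simp_all add: primes_less_67_def\<close>)
  next
    case 4
    show ?thesis
      by (rule contra[of 37 "[23, 29, 31]"]) (use 4 third_fourth_5_19 in \<open>simp_all add: primes_less_67_def\<close>)
  next
    case 5
    show ?thesis
      by (rule contra[of 31 "[29]"]) (use 5 third_fourth_5_23 in \<open>simp_all add: primes_less_67_def\<close>)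
  next
    case 6
    show ?thesis
      by (rule contra[of 29 "[13, 17, 19, 23]"]) (use 6 third_fourth_7_11 in \<open>simp_all add: primes_less_67_def\<close>)
  next
    case 7
    show ?thesis
      by (rule contra[of 23 "[17, 19]"]) (use 7 third_fourth_7_13 in \<open>simp_all add: primes_less_67_def\<close>)
  next
    case 8
    show ?thesis
      by (rule contra[of 19 "[]"]) (use 8 third_fourth_7_17 in \<open>simp_all add: primes_less_67_def\<close>)
  next
    case 9
    show ?thesis
      by (rule contra[of 23 "[]"]) (use 9 third_fourth_7_19 in \<open>simp_all add: primes_less_67_def\<close>)
  next
    case 10
    show ?thesis
      by (rule contra[of 29 "[]"]) (use 10 third_fourth_7_23 in \<open>simp_all add: primes_less_67_def\<close>)
  qed
qed

subsection \<open>Five cases for the reduced equation\<close>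

lemma prod_abund_le_power:
  assumes "finite S" "\<And>p. p \<in> S \<Longrightarrow> q \<le> p" "0 < q" "card S \<le> n"
  shows "(\<Prod>p\<in>S. abund p) \<le> abund q ^ n"
proof -
  have "(\<Prod>p\<in>S. abund p) \<le> (\<Prod>p\<in>S. abund q)"
    using assms by (intro prod_mono conjI abund_nonneg abund_antimono) auto
  also have "\<dots> = abund q ^ card S" by simp
  also have "\<dots> \<le> abund q ^ n" using assms by (intro power_increasing abund_ge_1)
  finally show ?thesis .
qed

lemma prime_mod3_eq_1:
  assumes "prime (p::nat)" "p mod 3 = 1"
  shows "p mod 6 = 1" "7 \<le> p"
proof -
  have "p \<noteq> 1" "2 dvd p \<longrightarrow> p = 2" using assms(1) primes_dvd_imp_eq[of 2 p] by auto
  with assms(2) show "p mod 6 = 1" "7 \<le> p" by presburger+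
qed

lemma odd_mod3_eq_2:
  assumes "odd (p::nat)" "p mod 3 = 2"
  shows "p mod 6 = 5" "5 \<le> p"
  using assms by presburger+

lemma sigma_sq_strict_mono: "p < q \<Longrightarrow> sigma_sq p < sigma_sq q"
  unfolding sigma_sq_def by (simp add: add_less_mono power_strict_mono)

lemma size_prime_factorization_pos: "x > 1 \<Longrightarrow> size (prime_factorization (x::nat)) \<ge> 1"
  using prime_factorization_empty_iff[of x] by (cases "prime_factorization x = {#}") (auto simp: Suc_le_eq nonempty_has_size)

lemma prime_if_size_prime_factorization:
  assumes "size (prime_factorization (x::nat)) = 1" "x > 0"
  shows "prime x"
proof -
  obtain p where p: "prime_factorization x = {#p#}" using assms(1) size_1_singleton_mset by blast
  then have "prime p" using in_prime_factors_imp_prime[of p x] by simp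
  moreover have "x = p" using prod_mset_prime_factorization_nat[of x] assms(2) p by simp
  ultimately show ?thesis by simp
qed

section \<open>The equations after removing the prime 3\<close>

text \<open>The original \<open>k\<close> is the square of 3 * q1 * q2 times the product of
  \<open>R\<close>, and \<open>9 * u\<close> is sigma(k) / m. The factor 13 is
  \<open>sigma_sq 3\<close>; the 9 has cancelled against one 3 in each of \<open>sigma_sq q1\<close>
  and \<open>sigma_sq q2\<close>. Since 3, \<open>q1\<close> and \<open>q2\<close> take three of the
  seven primes, four remain for \<open>R\<close> and \<open>m\<close>.\<close>

locale reduced_descartes =
  fixes q1 q2 m u :: nat and R :: "nat set"
  assumes q: "prime q1" "prime q2" "q1 < q2" "q1 mod 3 = 1" "q2 mod 3 = 1"
    and R: "finite R" "\<And>r. r \<in> R \<Longrightarrow> prime r" "\<And>r. r \<in> R \<Longrightarrow> odd r" "\<And>r. r \<in> R \<Longrightarrow> r mod 3 = 2"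
    and pos: "0 < m" "0 < u"
    and sum_eq: "u * (m + 1) = 2 * ((q1 * q2)\<^sup>2 * (\<Prod>r\<in>R. r\<^sup>2))"
    and prod_eq: "u * m = 13 * (sigma_sq q1 div 3 * (sigma_sq q2 div 3)) * (\<Prod>r\<in>R. sigma_sq r)"
    and u_dvd: "u dvd (q1 * q2)\<^sup>2"
    and M_mod3: "\<And>l. l \<in> prime_factors m \<Longrightarrow> l mod 3 = 1"
    and M_cube_free: "\<And>l. prime l \<Longrightarrow> \<not> l ^ 3 dvd m"
    and M_card: "card (prime_factors m) + card R = 4"
begin

lemma q_bounds: "q1 mod 6 = 1" "q2 mod 6 = 1" "7 \<le> q1" "13 \<le> q2"
proof -
  show 1: "q1 mod 6 = 1" "q2 mod 6 = 1" "7 \<le> q1" using q prime_mod3_eq_1 by blast+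
  show "13 \<le> q2" using 1 q(3) by presburger
qed

lemma R_bounds: "r \<in> R \<Longrightarrow> r mod 6 = 5" "r \<in> R \<Longrightarrow> 5 \<le> r"
  using R odd_mod3_eq_2 by blast+

lemma triple_cofactor: "sigma_sq q1 = 3 * (sigma_sq q1 div 3)" "sigma_sq q2 = 3 * (sigma_sq q2 div 3)"
  using sigma_sq_one_mod3(1) q(4,5) by simp_all

text \<open>This is the quotient of \<open>prod_eq\<close> and \<open>sum_eq\<close>, in which
  \<open>u\<close> cancels.\<close>

lemma abund_prod: "abund q1 * abund q2 * (\<Prod>r\<in>R. abund r) = 18 / 13 * (1 - 1 / real (m + 1))"
proof -
  define S where "S = sigma_sq q1 * sigma_sq q2 * (\<Prod>r\<in>R. sigma_sq r)"
  define K where "K = (q1 * q2)\<^sup>2 * (\<Prod>r\<in>R. r\<^sup>2)"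
  have "9 * (u * m) = 13 * ((3 * (sigma_sq q1 div 3)) * (3 * (sigma_sq q2 div 3)) * (\<Prod>r\<in>R. sigma_sq r))"
    unfolding prod_eq by simp
  then have "9 * (u * m) = 13 * S" unfolding S_def triple_cofactor[symmetric] .
  then have "real (9 * (u * m)) = real (13 * S)" by (rule arg_cong)
  then have S: "real S = 9 * real u * real m / 13" by simp
  have "u * (m + 1) = 2 * K" using sum_eq by (simp add: K_def)
  then have "real (u * (m + 1)) = real (2 * K)" by (rule arg_cong)
  then have K: "real K = real u * real (m + 1) / 2" by (simp only: of_nat_mult)
  have "abund q1 * abund q2 * (\<Prod>r\<in>R. abund r) = real S / real K"
    by (simp add: S_def K_def abund_def prod_dividef power_mult_distrib prod_power_distrib)
  also have "\<dots> = 18 / 13 * (1 - 1 / real (m + 1))"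
  proof -
    have "1 - 1 / real (m + 1) = real m / real (m + 1)" by (simp add: field_simps)
    then show ?thesis unfolding S K using pos by simp
  qed
  finally show ?thesis .
qed

lemma abund_prod_less: "abund q1 * abund q2 * (\<Prod>r\<in>R. abund r) < 18 / 13"
  unfolding abund_prod by simp

lemma abund_prod_ge: "k \<le> m + 1 \<Longrightarrow> 0 < k \<Longrightarrow>
    18 / 13 * (1 - 1 / real k) \<le> abund q1 * abund q2 * (\<Prod>r\<in>R. abund r)"
  unfolding abund_prod by (simp add: frac_le)

text \<open>The smallest prime = 1 mod 3 is 7.\<close>

lemma m_ge: "7 ^ card (prime_factors m) \<le> m"
proof -
  have "7 ^ card (prime_factors m) = (\<Prod>l\<in>prime_factors m. 7)" by simp
  also have "\<dots> \<le> (\<Prod>l\<in>prime_factors m. l ^ multiplicity l m)"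
  proof (intro prod_mono conjI)
    fix l assume l: "l \<in> prime_factors m"
    then have "7 \<le> l" using prime_mod3_eq_1(2)[of l] M_mod3 by auto
    moreover have "0 < multiplicity l m" using l by (simp add: prime_factors_multiplicity)
    ultimately show "7 \<le> l ^ multiplicity l m"
      using self_le_power[of l "multiplicity l m"] by linarith
  qed simp
  also have "\<dots> = m" using prime_factorization_nat[of m] pos by simp
  finally show ?thesis .
qed

text \<open>By \<open>u_dvd\<close>, \<open>u\<close> is at most \<open>(q1 * q2)\<^sup>2\<close>,
  so cancelling \<open>u\<close> in \<open>sum_eq\<close> leaves at least the part coming from
  \<open>R\<close>.\<close>

lemma m_ge_R: "2 * (\<Prod>r\<in>R. r)\<^sup>2 \<le> m + 1"
proof -
  have "u \<le> (q1 * q2)\<^sup>2" using u_dvd q_bounds by (intro dvd_imp_le) auto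
  then have "u * (2 * (\<Prod>r\<in>R. r)\<^sup>2) \<le> (q1 * q2)\<^sup>2 * (2 * (\<Prod>r\<in>R. r)\<^sup>2)" by (rule mult_le_mono1)
  also have "\<dots> = u * (m + 1)" unfolding sum_eq by (simp add: prod_power_distrib)
  finally show ?thesis using pos(2) by (simp only: nat_mult_le_cancel1)
qed

text \<open>Such a prime divides \<open>u * m\<close>. The target set has at most
  \<open>6 - card R\<close> elements, which gives pigeonhole arguments for two and three primes in
  \<open>R\<close>.\<close>

lemma support:
  assumes "prime l" "l dvd 13 * (sigma_sq q1 div 3 * (sigma_sq q2 div 3)) * (\<Prod>r\<in>R. sigma_sq r)"
  shows "l \<in> {q1, q2} \<union> prime_factors m"
proof -
  have "l dvd u \<or> l dvd m" using assms prime_dvd_mult_iff[of l u m] unfolding prod_eq[symmetric] by blast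
  then show ?thesis
  proof
    assume "l dvd u"
    then have "l dvd q1 * q2" using u_dvd assms(1) by (meson dvd_trans prime_dvd_power)
    then have "l dvd q1 \<or> l dvd q2" using assms(1) prime_dvd_mult_iff by blast
    then show ?thesis using assms(1) q primes_dvd_imp_eq by blast
  next
    assume "l dvd m"
    then show ?thesis using assms(1) pos by (simp add: in_prime_factors_iff)
  qed
qed

text \<open>Otherwise \<open>m = 1\<close>, and the product of abundancies, each at least 1, would
  be 9/13.\<close>

lemma card_R_le_3: "card R \<le> 3"
proof (rule ccontr)
  assume "\<not> card R \<le> 3"
  then have "card (prime_factors m) = 0" using M_card by linarith
  then have "prime_factors m = {}" by simp
  then have "m = 1" using pos by (simp add: prime_factorization_empty_iff)
  then have "abund q1 * abund q2 * (\<Prod>r\<in>R. abund r) < 1" unfolding abund_prod by simp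
  moreover have "1 \<le> abund q1 * abund q2 * (\<Prod>r\<in>R. abund r)"
  proof -
    have "1 \<le> (\<Prod>r\<in>R. abund r)" using R_bounds by (intro prod_ge_1 abund_ge_1) force
    moreover have "1 \<le> abund q1" "1 \<le> abund q2" using q_bounds by (auto intro: abund_ge_1)
    ultimately show ?thesis
      using mult_mono[of 1 "abund q1" 1 "abund q2"]
        mult_mono[of 1 "abund q1 * abund q2" 1 "\<Prod>r\<in>R. abund r"] by simp
  qed
  ultimately show False by simp
qed

text \<open>Here \<open>m\<close> is at least 7^4, so the product is close to 18/13, whereas
  \<open>abund 7 * abund 13\<close> is only about 1.26.\<close>

lemma card_R_not_0: "card R \<noteq> 0"
proof
  assume "card R = 0"
  then have "R = {}" "card (prime_factors m) = 4" using R M_card by auto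
  then have "18 / 13 * (1 - 1 / real 2401) \<le> abund q1 * abund q2"
    using m_ge abund_prod_ge[of 2401] by simp
  also have "\<dots> \<le> abund 7 * abund 13"
    using q_bounds by (intro mult_mono abund_antimono) (auto simp: abund_def)
  finally show False by (simp add: abund_def sigma_sq_def)
qed

text \<open>Here \<open>m\<close> is at least 7^3; in the resulting window, the residues modulo 6
  leave only \<open>q1 = 7\<close>, \<open>q2 = 13\<close>, \<open>r = 11\<close>.\<close>

lemma card_R_not_1: "card R \<noteq> 1"
proof
  assume "card R = 1"
  then obtain r where Rr: "R = {r}" by (rule card_1_singletonE)
  have M3: "card (prime_factors m) = 3" using M_card by (simp add: Rr)
  have r: "r mod 6 = 5" "5 \<le> r" using R_bounds Rr by auto
  define F where "F = abund q1 * abund q2 * abund r"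
  have up: "F < 18 / 13" using abund_prod_less by (simp add: F_def Rr)
  have low: "18 / 13 * (1 - 1 / 343) \<le> F"
    using m_ge abund_prod_ge[of 343] unfolding M3 by (simp add: F_def Rr)
  have mono: "abund a * abund b * abund c \<le> abund a' * abund b' * abund c'"
    if "0 < a'" "0 < b'" "0 < c'" "a' \<le> a" "b' \<le> b" "c' \<le> c" for a b c a' b' c'
    by (intro mult_mono mult_nonneg_nonneg abund_nonneg abund_antimono that)
  have upper: "\<not> (a \<le> q1 \<and> b \<le> q2 \<and> c \<le> r)"
    if "0 < a" "0 < b" "0 < c" "abund a * abund b * abund c < 18 / 13 * (1 - 1 / 343)" for a b c
    using mono[of a b c q1 q2 r] that low unfolding F_def by linarith
  have lower: "\<not> (q1 \<le> a \<and> q2 \<le> b \<and> r \<le> c)"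
    if "18 / 13 \<le> abund a * abund b * abund c" for a b c
    using mono[of q1 q2 r a b c] that up q_bounds r unfolding F_def by linarith
  \<comment> \<open>At each of these corners the product is already below the lower bound. The
    coordinates run through residue classes modulo 6, so 25 may occur.\<close>
  have no: "\<not> (19 \<le> q1 \<and> 25 \<le> q2 \<and> 5 \<le> r)" "\<not> (13 \<le> q1 \<and> 37 \<le> q2 \<and> 5 \<le> r)"
    "\<not> (7 \<le> q1 \<and> 13 \<le> q2 \<and> 17 \<le> r)" "\<not> (7 \<le> q1 \<and> 19 \<le> q2 \<and> 11 \<le> r)"
    "\<not> (13 \<le> q1 \<and> 19 \<le> q2 \<and> 11 \<le> r)"
    by (intro upper; simp add: abund_def sigma_sq_def)+
  have no_13: "\<not> (q1 \<le> 13 \<and> q2 \<le> 31 \<and> r \<le> 5)"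
    by (intro lower; simp add: abund_def sigma_sq_def)
  \<comment> \<open>The abundancies of 7 and 5 alone exceed 18/13, whatever \<open>q2\<close>
    is.\<close>
  have no_7: "\<not> (q1 \<le> 7 \<and> r \<le> 5)"
  proof
    assume "q1 \<le> 7 \<and> r \<le> 5"
    then have "abund 7 * abund 5 * 1 \<le> abund q1 * abund r * abund q2"
      using q_bounds r
      by (intro mult_mono mult_nonneg_nonneg abund_nonneg abund_antimono abund_ge_1) auto
    moreover have "18 / 13 \<le> abund 7 * abund 5 * 1" by (simp add: abund_def sigma_sq_def)
    ultimately show False using up by (simp add: F_def mult_ac)
  qed
  have q1_gap: "q1 = 7 \<or> 13 \<le> q1" using mod_6_gap[of 7 q1] q_bounds by simp
  have r_gap: "r = 5 \<or> 11 \<le> r" using mod_6_gap[of 5 r] r by simp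
  have "r \<noteq> 5"
  proof
    assume "r = 5"
    then have "13 \<le> q1" using q1_gap no_7 by auto
    then have "q2 < 37" using no(2) r by auto
    then have "q2 \<le> 31" using mod_6_gap[of q2 37] q_bounds by simp
    then have "\<not> q1 \<le> 13" using no_13 \<open>r = 5\<close> by auto
    then have "19 \<le> q1" using mod_6_gap[of 13 q1] q_bounds by simp
    moreover from this have "25 \<le> q2" using mod_6_gap[of q1 q2] q_bounds q(3) by simp
    ultimately show False using no(1) r by auto
  qed
  then have r11: "11 \<le> r" using r_gap by blast
  have "q1 = 7"
  proof (rule ccontr)
    assume "q1 \<noteq> 7"
    then have "13 \<le> q1" using q1_gap by blast
    moreover from this have "19 \<le> q2" using mod_6_gap[of q1 q2] q_bounds q(3) by simp
    ultimately show False using no(5) r11 by auto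
  qed
  moreover have "q2 = 13" using mod_6_gap[of 13 q2] q_bounds no(4) r11 by auto
  moreover have "r = 11" using mod_6_gap[of 11 r] r r11 no(3) q_bounds by auto
  ultimately have special: "q1 = 7" "q2 = 13" "r = 11" .
  \<comment> \<open>This is Descartes' own example with \<open>m\<close> = 22021 = 19^2 * 61, which
    has two prime factors where three are required.\<close>
  have "u * m = 2003911" using prod_eq by (simp add: special Rr sigma_sq_def)
  moreover have "u * m + u = 2004002" using sum_eq by (simp add: special Rr)
  ultimately have "u = 91" by simp
  then have m: "m = 19 * 19 * 61" using \<open>u * m = 2003911\<close> by simp
  have "prime_factors m \<subseteq> {19, 61}"
  proof
    fix l assume "l \<in> prime_factors m"
    then have l: "prime l" "l dvd 19 * 19 * 61" by (auto simp: m)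
    then have "l dvd 19 \<or> l dvd 61" using prime_dvd_mult_iff by blast
    then show "l \<in> {19, 61}" using primes_dvd_imp_eq[OF l(1)] by auto
  qed
  from card_mono[OF _ this] show False by (simp add: M3)
qed

text \<open>Sorts \<open>q1\<close>, \<open>q2\<close> and \<open>R\<close> into one increasing list
  for \<open>no_four_primes\<close>, with the lower bound supplied by \<open>m_ge_R\<close>.\<close>

lemma card_R_not_2: "card R \<noteq> 2"
proof
  assume "card R = 2"
  then obtain r1 r2 where Rr: "R = {r1, r2}" "r1 \<noteq> r2" by (meson card_2_iff)
  define A where "A = {q1, q2} \<union> R"
  have disj: "q1 \<notin> R" "q2 \<notin> R" using R q by auto
  have finA: "finite A" using R by (simp add: A_def)
  have "card A = 4" using disj q(3) Rr by (auto simp: A_def)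
  define xs where "xs = sorted_list_of_set A"
  have xs: "set xs = A" "sorted_wrt (<) xs" "distinct xs" "length xs = 4"
    using finA \<open>card A = 4\<close> by (simp_all add: xs_def)
  then obtain a b c d where abcd: "xs = [a, b, c, d]"
    by (auto simp: length_Suc_conv eval_nat_numeral)
  have inA: "a \<in> A" "b \<in> A" "c \<in> A" "d \<in> A" using xs(1) by (auto simp: abcd)
  have ord: "a < b" "b < c" "c < d" using xs(2) by (simp_all add: abcd)
  have primeA: "prime p" "5 \<le> p" if "p \<in> A" for p
    using that R q R_bounds q_bounds unfolding A_def by force+
  have set_rs: "set (filter (\<lambda>p. p mod 3 = 2) xs) = R"
    using R q by (auto simp: xs(1) A_def)
  have dist_rs: "distinct (filter (\<lambda>p. p mod 3 = 2) xs)" using xs(3) by simp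
  have len: "length (filter (\<lambda>p. p mod 3 = 2) [a, b, c, d]) = 2"
    using distinct_card[OF dist_rs] \<open>card R = 2\<close> unfolding set_rs by (simp only: abcd)
  have "\<Prod>R = prod_list (filter (\<lambda>p. p mod 3 = 2) xs)"
    using prod.distinct_set_conv_list[OF dist_rs, of "\<lambda>p. p"] unfolding set_rs by simp
  then have prod_rs: "prod_list (filter (\<lambda>p. p mod 3 = 2) [a, b, c, d]) = \<Prod>R"
    by (simp only: abcd)
  have "(\<Prod>p\<in>A. abund p) = abund q1 * abund q2 * (\<Prod>r\<in>R. abund r)"
    using disj q(3) R(1) by (simp add: A_def)
  moreover have "(\<Prod>p\<in>A. abund p) = abund a * abund b * abund c * abund d"
    using prod.distinct_set_conv_list[OF xs(3), of abund] unfolding xs(1) by (simp add: abcd)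
  ultimately have F: "abund a * abund b * abund c * abund d = abund q1 * abund q2 * (\<Prod>r\<in>R. abund r)"
    by simp
  have R0: "0 < \<Prod>R" using R_bounds(2) by (intro prod_pos) force
  have "18 / 13 * (1 - 1 / real (2 * (\<Prod>R)\<^sup>2)) \<le> abund a * abund b * abund c * abund d"
    unfolding F using m_ge_R R0 by (intro abund_prod_ge) auto
  then have low: "18 / 13 * (1 - 1 / (2 * (real (\<Prod>R))\<^sup>2)) \<le> abund a * abund b * abund c * abund d"
    by simp
  \<comment> \<open>The divisor sums of 5^2 and 11^2 are 31 and 7 * 19; together with 13 these
    primes fill all four places in \<open>T\<close>.\<close>
  have not_5_11: "\<not> (a = 5 \<and> b = 11)"
  proof
    assume ab: "a = 5 \<and> b = 11"
    then have "5 \<in> R" "11 \<in> R" using inA q by (auto simp: A_def)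
    then have R511: "R = {5, 11}" using Rr by auto
    define T where "T = {q1, q2} \<union> prime_factors m"
    have T: "l \<in> T" if "prime l" "l dvd 13 * (sigma_sq q1 div 3 * (sigma_sq q2 div 3)) * (31 * (7 * 19))" for l
      using support[of l] that by (simp add: R511 sigma_sq_def T_def)
    have "{7, 13, 19, 31} \<subseteq> T" by (auto intro!: T)
    moreover have "card T \<le> 4"
    proof -
      have "card T \<le> card {q1, q2} + card (prime_factors m)" unfolding T_def by (rule card_Un_le)
      also have "\<dots> \<le> 4" using M_card \<open>card R = 2\<close> q(3) by simp
      finally show ?thesis .
    qed
    ultimately have T_eq: "T = {7, 13, 19, 31}"
      using card_seteq[of T "{7, 13, 19, 31}"] by (simp add: T_def)
    \<comment> \<open>Both \<open>q1\<close> and \<open>q2\<close> exceed 11, so they are 13, 19 or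
      31. But 13 would bring 61 = 183 / 3 into \<open>T\<close>, and 19 would bring 127 = 381 /
      3.\<close>
    have q_eq_31: "x = 31" if x: "x \<in> {q1, q2}" for x
    proof -
      have "x \<in> A" "x \<notin> R" using x disj by (auto simp: A_def)
      then have "x \<in> {c, d}" using xs(1) abcd ab R511 by auto
      then have "x > 11" using ord ab by auto
      moreover have "x \<in> T" using x by (auto simp: T_def)
      moreover have "x \<noteq> 13"
      proof
        assume "x = 13"
        then have "61 \<in> T" using x by (intro T) (auto simp: sigma_sq_def)
        then show False by (simp add: T_eq)
      qed
      moreover have "x \<noteq> 19"
      proof
        assume "x = 19"
        then have "127 \<in> T" using x by (intro T) (auto simp: sigma_sq_def)
        then show False by (simp add: T_eq)
      qed
      ultimately show ?thesis by (auto simp: T_eq)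
    qed
    have "q1 = 31" "q2 = 31" by (simp_all add: q_eq_31)
    then show False using q(3) by simp
  qed
  show False
    using no_four_primes[OF primeA(1)[OF inA(1)] primeA(1)[OF inA(2)] primeA(1)[OF inA(3)]
        primeA(1)[OF inA(4)] primeA(2)[OF inA(1)] ord len _ _ not_5_11]
      low abund_prod_less unfolding prod_rs F by blast
qed

text \<open>Here \<open>u * m\<close> has at most six prime factors with multiplicity but six factors greater than 1, so
  all of these are primes among \<open>q1\<close>, \<open>q2\<close> and the prime dividing \<open>m\<close>.\<close>

lemma card_R_not_3: "card R \<noteq> 3"
proof
  assume R3: "card R = 3"
  then obtain r1 r2 r3 where Rr: "R = {r1, r2, r3}" "r1 \<noteq> r2" "r1 \<noteq> r3" "r2 \<noteq> r3"
    by (auto simp: card_Suc_eq eval_nat_numeral)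
  have "card (prime_factors m) = 1" using M_card R3 by simp
  then obtain l where l: "prime_factors m = {l}" by (rule card_1_singletonE)
  then have "prime l" using in_prime_factors_imp_prime by blast
  let ?\<Omega> = "\<lambda>x::nat. size (prime_factorization x)"
  have "?\<Omega> m \<le> 2"
  proof -
    have "multiplicity l m < 3"
      using M_cube_free[OF \<open>prime l\<close>] multiplicity_dvd'[of 3 l m] by linarith
    moreover have "?\<Omega> m = multiplicity l m"
      using l \<open>prime l\<close> by (simp add: size_multiset_overloaded_eq count_prime_factorization_prime)
    ultimately show ?thesis by simp
  qed
  moreover have "?\<Omega> u \<le> 4"
  proof -
    have "?\<Omega> u \<le> ?\<Omega> ((q1 * q2)\<^sup>2)"
      using u_dvd q_bounds pos by (intro size_mset_mono) (simp add: prime_factorization_subset_iff_dvd)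
    also have "\<dots> = 4"
      using q prime_gt_0_nat by (simp add: power2_eq_square prime_factorization_mult prime_factorization_prime)
    finally show ?thesis .
  qed
  moreover have "?\<Omega> (u * m) = ?\<Omega> u + ?\<Omega> m"
    using pos by (simp add: prime_factorization_mult)
  moreover have gt1: "sigma_sq q1 div 3 > 1" "sigma_sq q2 div 3 > 1"
    using triple_cofactor sigma_sq_strict_mono[of 3 q1] sigma_sq_strict_mono[of 3 q2] q_bounds
    by (auto simp: sigma_sq_def)
  moreover have gr: "sigma_sq r > 1" if "r \<in> R" for r
    using R_bounds(2)[OF that] by (simp add: sigma_sq_def)
  moreover have "u * m = 13 * (sigma_sq q1 div 3) * (sigma_sq q2 div 3) * sigma_sq r1 * sigma_sq r2 * sigma_sq r3"
    using prod_eq Rr by simp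
  moreover have "?\<Omega> (x1 * x2 * x3 * x4 * x5 * x6) = ?\<Omega> x1 + ?\<Omega> x2 + ?\<Omega> x3 + ?\<Omega> x4 + ?\<Omega> x5 + ?\<Omega> x6"
    if "x1 > 1" "x2 > 1" "x3 > 1" "x4 > 1" "x5 > 1" "x6 > 1" for x1 x2 x3 x4 x5 x6
    using that by (simp add: prime_factorization_mult)
  ultimately have "?\<Omega> 13 + ?\<Omega> (sigma_sq q1 div 3) + ?\<Omega> (sigma_sq q2 div 3)
      + ?\<Omega> (sigma_sq r1) + ?\<Omega> (sigma_sq r2) + ?\<Omega> (sigma_sq r3) \<le> 6"
    using Rr(1) by simp
  moreover have "?\<Omega> 13 \<ge> 1" "?\<Omega> (sigma_sq q1 div 3) \<ge> 1" "?\<Omega> (sigma_sq q2 div 3) \<ge> 1"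
    "?\<Omega> (sigma_sq r1) \<ge> 1" "?\<Omega> (sigma_sq r2) \<ge> 1" "?\<Omega> (sigma_sq r3) \<ge> 1"
    by (intro size_prime_factorization_pos gt1 gr; simp add: Rr(1))+
  ultimately have "?\<Omega> (sigma_sq r1) = 1" "?\<Omega> (sigma_sq r2) = 1" "?\<Omega> (sigma_sq r3) = 1"
    by linarith+
  then have "prime (sigma_sq r)" if "r \<in> R" for r
    using that gr[OF that] Rr(1) by (intro prime_if_size_prime_factorization) auto
  then have "sigma_sq r \<in> {q1, q2} \<union> prime_factors m" if "r \<in> R" for r
    using that R(1) by (intro support dvd_mult dvd_prodI)
  then have "sigma_sq ` R \<subseteq> {q1, q2, l}" unfolding l by auto
  moreover have "card (sigma_sq ` R) = 3"
  proof -
    have "strict_mono sigma_sq" using sigma_sq_strict_mono by (rule strict_monoI)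
    then show ?thesis using R3 card_image strict_mono_imp_inj_on by metis
  qed
  moreover have "card {q1, q2, l} \<le> 3" by (simp add: card_insert_if)
  \<comment> \<open>Three distinct primes \<open>sigma_sq r\<close> fill a set of at most three
    elements. That set also contains 13, but \<open>sigma_sq r\<close> is at least 31 for
    \<open>r\<close> at least 5.\<close>
  ultimately have "sigma_sq ` R = {q1, q2, l}" by (intro card_seteq) auto
  moreover have "13 \<in> {q1, q2, l}" using support[of 13] l by auto
  ultimately obtain r where r: "r \<in> R" "sigma_sq r = 13" by force
  have "sigma_sq 5 \<le> sigma_sq r"
    using R_bounds(2)[OF r(1)] sigma_sq_strict_mono[of 5 r] by (cases "r = 5") auto
  with r(2) show False by (simp add: sigma_sq_def)
qed

lemma contradiction: False
proof -
  have "card R = 0 \<or> card R = 1 \<or> card R = 2 \<or> card R = 3" using card_R_le_3 by linarith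
  then show False using card_R_not_0 card_R_not_1 card_R_not_2 card_R_not_3 by blast
qed

end

subsection \<open>Reduction to the five cases\<close>

locale descartes_seven =
  fixes k m t :: nat
  assumes pos: "0 < k" "0 < m" and odd: "odd k" "odd m"
    and sigma_eq: "sigma k = m * t" and k_eq: "t * (m + 1) = 2 * k"
    and k_squares: "k = (\<Prod>p\<in>prime_factors k. p\<^sup>2)"
    and coprime_k_m: "coprime k m"
    and m_cube_free: "\<And>l. prime l \<Longrightarrow> \<not> l ^ 3 dvd m"
    and seven: "card (prime_factors k) + card (prime_factors m) = 7"
begin

abbreviation "P \<equiv> prime_factors k"

lemma P: "p \<in> P \<Longrightarrow> prime p" "p \<in> P \<Longrightarrow> odd p" "p \<in> P \<Longrightarrow> 3 \<le> p"
proof -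
  assume p: "p \<in> P"
  then show "prime p" by auto
  show "odd p" using p odd by (auto simp: in_prime_factors_iff)
  with \<open>prime p\<close> show "3 \<le> p" using prime_gt_1_nat[of p] by presburger
qed

lemma t_pos: "0 < t"
  using k_eq pos by (cases t) auto

lemma t_dvd_k: "t dvd k"
proof -
  have "2 dvd m + 1" using odd(2) by simp
  then obtain j where j: "m + 1 = 2 * j" by blast
  have "2 * (t * j) = 2 * k" using k_eq unfolding j by simp
  then show ?thesis by (metis dvd_triv_left mult_cancel1 zero_neq_numeral)
qed

text \<open>For \<open>m = 1\<close> the equations give sigma(k) = k, although 1 and
  \<open>k\<close> are distinct divisors.\<close>

lemma m_gt_1: "1 < m"
proof (rule ccontr)
  assume "\<not> 1 < m"
  then have "m = 1" using pos by simp
  then have "t = k" "prime_factors m = {}" using k_eq by auto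
  then have "card P = 7" using seven by simp
  then have "k \<noteq> 1" by auto
  have fin: "finite {d. d dvd k}" using pos by simp
  have "1 + k = (\<Sum>d\<in>{1, k}. d)" using \<open>k \<noteq> 1\<close> by simp
  also have "\<dots> \<le> (\<Sum>d | d dvd k. d)" using fin by (intro sum_mono2) auto
  also have "\<dots> = k" using sigma_eq \<open>m = 1\<close> \<open>t = k\<close> by (simp add: sigma_def)
  finally show False by simp
qed

lemma card_P_le_6: "card P \<le> 6"
proof -
  have "prime_factors m \<noteq> {}" using m_gt_1 by (simp add: prime_factorization_empty_iff)
  then have "card (prime_factors m) \<noteq> 0" by simp
  then show ?thesis using seven by linarith
qed

lemma sigma_k: "m * t = (\<Prod>p\<in>P. sigma_sq p)"
  using sigma_prod_squares[of P] P(1) k_squares sigma_eq by simp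

lemma prime_dvd_sigma:
  assumes "prime l" "l dvd m * t"
  shows "l = 3 \<or> l mod 3 = 1"
proof -
  have "\<exists>p\<in>P. l dvd sigma_sq p"
    using assms unfolding sigma_k by (simp add: prime_dvd_prod_iff)
  then show ?thesis using prime_dvd_sigma_sq assms(1) by blast
qed

lemma abund_prod: "(\<Prod>p\<in>P. abund p) = 2 - 2 / real (m + 1)"
proof -
  have "real (t * (m + 1)) = real (2 * k)" using k_eq by (rule arg_cong)
  then have k: "real k = real t * real (m + 1) / 2" by (simp only: of_nat_mult)
  have "(\<Prod>p\<in>P. abund p) = real (\<Prod>p\<in>P. sigma_sq p) / real (\<Prod>p\<in>P. p\<^sup>2)"
    by (simp add: abund_def prod_dividef)
  also have "\<dots> = real (m * t) / real k" unfolding sigma_k[symmetric] k_squares[symmetric] ..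
  also have "\<dots> = 2 * (real m / real (m + 1))" unfolding k using t_pos by simp
  also have "\<dots> = 2 - 2 / real (m + 1)" by (simp add: field_simps)
  finally show ?thesis .
qed

lemma square_mod_3: "\<not> 3 dvd (x::nat) \<Longrightarrow> x\<^sup>2 mod 3 = 1"
proof -
  assume "\<not> 3 dvd x"
  then have "x mod 3 = 1 \<or> x mod 3 = 2" by presburger
  then have "(x mod 3)\<^sup>2 mod 3 = 1" by auto
  then show ?thesis by (simp add: power_mod)
qed

text \<open>Otherwise \<open>t\<close> and the square \<open>k\<close> are both 1 mod 3, hence so is
  \<open>m\<close>. Then 3 does not divide \<open>m * t\<close>, so all primes of \<open>k\<close>
  are 2 mod 3, while those of its divisor \<open>t\<close> are 1 mod 3; thus \<open>t = 1\<close>.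
  Now the product of abundancies is 2 - 1/k, out of reach for at most six primes, of which only one
  can be 5 and the others are at least 11.\<close>

lemma three_dvd_k: "3 dvd k"
proof (rule ccontr)
  assume not_3: "\<not> 3 dvd k"
  have "t mod 3 = 1"
  proof (rule mod3_eq_1_if_prime_factors[OF t_pos])
    fix l assume l: "prime l" "l dvd t"
    then have "l \<noteq> 3" using t_dvd_k not_3 by auto
    with prime_dvd_sigma[of l] l show "l mod 3 = 1" by auto
  qed
  have ksq: "k = (\<Prod>P)\<^sup>2" using k_squares by (simp add: prod_power_distrib)
  have "\<not> 3 dvd \<Prod>P" using not_3 ksq by (metis dvd_mult power2_eq_square)
  then have "k mod 3 = 1" using square_mod_3 ksq by metis
  have "(t mod 3 * ((m + 1) mod 3)) mod 3 = (2 * (k mod 3)) mod 3"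
    using k_eq by (metis mod_mult_eq mod_mult_right_eq)
  then have "m mod 3 = 1" using \<open>t mod 3 = 1\<close> \<open>k mod 3 = 1\<close> by simp presburger
  then have "\<not> 3 dvd m" "\<not> 3 dvd t" using \<open>t mod 3 = 1\<close> by presburger+
  then have "\<not> 3 dvd m * t" by (simp add: prime_dvd_mult_iff)
  then have mod2: "p mod 3 = 2" if "p \<in> P" for p
  proof -
    have "\<not> 3 dvd sigma_sq p"
      using \<open>\<not> 3 dvd m * t\<close> that unfolding sigma_k by (meson dvd_prodI dvd_trans finite_set_mset)
    then have "p mod 3 \<noteq> 1" using sigma_sq_one_mod3(1) by blast
    moreover have "\<not> 3 dvd p" using that not_3 by (auto simp: in_prime_factors_iff)
    ultimately show ?thesis by presburger
  qed
  have "t = 1"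
  proof (rule ccontr)
    assume "t \<noteq> 1"
    then obtain l where l: "prime l" "l dvd t" using prime_factor_nat by blast
    then have "l \<in> P" using t_dvd_k pos by (auto simp: in_prime_factors_iff)
    then show False using mod2 prime_dvd_sigma[of l] l by fastforce
  qed
  then have "m + 1 = 2 * k" using k_eq by simp
  then have F: "(\<Prod>p\<in>P. abund p) = 2 - 1 / real k" unfolding abund_prod by simp
  have P_ge: "5 \<le> p" if "p \<in> P" for p using odd_mod3_eq_2 mod2 P(2) that by blast
  have P_ge_11: "11 \<le> p" if "p \<in> P" "p \<noteq> 5" for p
    using odd_mod3_eq_2[OF P(2)[OF that(1)] mod2[OF that(1)]] that by presburger
  have "k > 1" using \<open>t = 1\<close> k_eq m_gt_1 by simp
  then obtain p where p: "p \<in> P" using prime_factor_nat[of k] pos by (auto simp: in_prime_factors_iff)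
  have sq_le: "(\<Prod>p\<in>S. p\<^sup>2) \<le> k" if "S \<subseteq> P" for S
  proof -
    have "(\<Prod>p\<in>S. p\<^sup>2) dvd (\<Prod>p\<in>P. p\<^sup>2)" using that by (intro prod_dvd_prod_subset) auto
    then show ?thesis using k_squares pos by (metis dvd_imp_le)
  qed
  have "25 \<le> k"
    using sq_le[of "{p}"] p power_mono[OF P_ge[OF p], of 2] by simp
  then have low: "2 - 1 / 25 \<le> (\<Prod>p\<in>P. abund p)" unfolding F by (simp add: frac_le)
  show False
  proof (cases "5 \<in> P")
    case False
    then have "(\<Prod>p\<in>P. abund p) \<le> abund 11 ^ 6"
      using P_ge_11 card_P_le_6 by (intro prod_abund_le_power) auto
    also have "\<dots> < 2 - 1 / 25" by (simp add: abund_def sigma_sq_def power_divide)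
    finally show False using low by simp
  next
    case True
    have split: "(\<Prod>p\<in>P. abund p) = abund 5 * (\<Prod>p\<in>P - {5}. abund p)"
      using True by (intro prod.remove) auto
    show False
    proof (cases "P - {5} = {}")
      case True
      then show False using low unfolding split True by (simp add: abund_def sigma_sq_def)
    next
      case False
      then obtain p where p: "p \<in> P" "p \<noteq> 5" by auto
      \<comment> \<open>The earlier bound 2 - 1/25 lies below \<open>abund 5 * abund 11 ^ 5\<close>,
        about 1.99; a second prime sharpens it with 3025 = (5 * 11)^2.\<close>
      have "3025 \<le> k"
        using sq_le[of "{5, p}"] p True power_mono[OF P_ge_11[OF p], of 2] by simp
      then have "2 - 1 / 3025 \<le> (\<Prod>p\<in>P. abund p)" unfolding F by (simp add: frac_le)
      also have "\<dots> \<le> abund 5 * abund 11 ^ 5"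
        unfolding split using P_ge_11 card_P_le_6 True
        by (intro mult_left_mono prod_abund_le_power abund_nonneg) auto
      also have "\<dots> < 2 - 1 / 3025" by (simp add: abund_def sigma_sq_def power_divide)
      finally show False by simp
    qed
  qed
qed

abbreviation "Q \<equiv> {p \<in> P. p mod 3 = 1}"
abbreviation "R \<equiv> {p \<in> P. p mod 3 = 2}"

lemma three_in_P: "3 \<in> P"
  using three_dvd_k pos by (simp add: in_prime_factors_iff)

lemma prod_P: "(\<Prod>p\<in>P. f p) = f 3 * ((\<Prod>p\<in>Q. f p) * (\<Prod>p\<in>R. f p))" for f :: "nat \<Rightarrow> nat"
proof -
  have "P = insert 3 (Q \<union> R)"
  proof (intro equalityI subsetI)
    fix p assume p: "p \<in> P"
    then have "p = 3 \<or> \<not> 3 dvd p" using P(1) primes_dvd_imp_eq[of 3 p] by auto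
    then show "p \<in> insert 3 (Q \<union> R)" using p by simp presburger
  qed (use three_in_P in auto)
  then have "(\<Prod>p\<in>P. f p) = (\<Prod>p\<in>insert 3 (Q \<union> R). f p)" by (rule arg_cong)
  also have "\<dots> = f 3 * (\<Prod>p\<in>Q \<union> R. f p)" by (subst prod.insert) auto
  also have "(\<Prod>p\<in>Q \<union> R. f p) = (\<Prod>p\<in>Q. f p) * (\<Prod>p\<in>R. f p)"
    by (intro prod.union_disjoint) auto
  finally show ?thesis .
qed

text \<open>Compares the exponents of 2 in \<open>prod_P\<close> for the constant function
  2.\<close>

lemma card_P: "card P = 1 + card Q + card R"
proof -
  have "(\<Prod>p\<in>P. 2) = 2 * ((\<Prod>p\<in>Q. 2) * (\<Prod>p\<in>R. 2::nat))" by (rule prod_P)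
  then have "2 ^ card P = (2::nat) ^ (1 + card Q + card R)" by (simp add: power_add)
  then show ?thesis by (rule power_inject_exp[THEN iffD1, rotated]) simp
qed

lemma m_mod_3: "l \<in> prime_factors m \<Longrightarrow> l mod 3 = 1" "m mod 3 = 1"
proof -
  have "\<not> 3 dvd m" using coprime_common_divisor_nat[OF coprime_k_m three_dvd_k] by auto
  then have *: "l mod 3 = 1" if "prime l" "l dvd m" for l
    using prime_dvd_sigma[of l] that by auto
  then show "l \<in> prime_factors m \<Longrightarrow> l mod 3 = 1" by (auto simp: in_prime_factors_iff)
  show "m mod 3 = 1" using * by (rule mod3_eq_1_if_prime_factors[OF pos(2)])
qed

text \<open>Since \<open>m\<close> is 1 mod 3, the square of 3 in \<open>k\<close> goes entirely
  into \<open>t\<close>. Counting factors 3 in the divisor sum then shows that \<open>Q\<close> has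
  two elements, and the reduced equations result.\<close>

lemma contradiction: False
proof -
  define K where "K = (\<Prod>p\<in>Q. p\<^sup>2) * (\<Prod>p\<in>R. p\<^sup>2)"
  have k9: "k = 9 * K" using k_squares prod_P[of "\<lambda>p. p\<^sup>2"] by (simp add: K_def)
  have "coprime 9 (m + 1)"
  proof -
    have "\<not> 3 dvd m + 1" using m_mod_3(2) by presburger
    then have "coprime 3 (m + 1)" by (intro prime_imp_coprime) auto
    then have "coprime (3 ^ 2) (m + 1)" by (rule coprime_power_left_iff[THEN iffD2, OF disjI1])
    then show ?thesis by simp
  qed
  moreover have "9 dvd t * (m + 1)" unfolding k_eq k9 by simp
  ultimately have "9 dvd t" using coprime_dvd_mult_left_iff by blast
  then obtain u where u: "t = 9 * u" by blast
  have sum_eq: "u * (m + 1) = 2 * K" using k_eq unfolding u k9 by simp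
  define X where "X = 13 * (\<Prod>p\<in>Q. sigma_sq p div 3) * (\<Prod>p\<in>R. sigma_sq p)"
  have "(\<Prod>p\<in>Q. sigma_sq p) = (\<Prod>p\<in>Q. 3 * (sigma_sq p div 3))"
    using sigma_sq_one_mod3(1) by (intro prod.cong) auto
  then have prod_Q: "(\<Prod>p\<in>Q. sigma_sq p) = 3 ^ card Q * (\<Prod>p\<in>Q. sigma_sq p div 3)"
    by (simp add: prod.distrib)
  have eq_X: "3\<^sup>2 * (u * m) = 3 ^ card Q * X"
    using sigma_k prod_P[of sigma_sq] prod_Q unfolding u by (simp add: X_def sigma_sq_def[of 3] mult_ac)
  have not_3_K: "\<not> 3 dvd K"
  proof
    assume "3 dvd K"
    then have "(\<exists>p\<in>Q. 3 dvd p\<^sup>2) \<or> (\<exists>p\<in>R. 3 dvd p\<^sup>2)"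
      by (simp add: K_def prime_dvd_mult_iff prime_dvd_prod_iff)
    then have "\<exists>p\<in>Q \<union> R. 3 dvd p" using prime_dvd_power[of "3::nat"] by auto
    then show False by (auto simp: dvd_eq_mod_eq_0)
  qed
  have not_3_u: "\<not> 3 dvd u"
  proof
    assume "3 dvd u"
    then have "3 dvd 2 * K" unfolding sum_eq[symmetric] by simp
    then show False using not_3_K by (simp add: prime_dvd_mult_iff)
  qed
  have "\<not> 3 dvd X"
  proof
    assume "3 dvd X"
    then have "(\<exists>p\<in>Q. 3 dvd sigma_sq p div 3) \<or> (\<exists>p\<in>R. 3 dvd sigma_sq p)"
      by (simp add: X_def prime_dvd_mult_iff prime_dvd_prod_iff)
    then show False
    proof
      assume "\<exists>p\<in>Q. 3 dvd sigma_sq p div 3"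
      then obtain p where p: "p mod 3 = 1" "3 dvd sigma_sq p div 3" by auto
      then have "9 dvd sigma_sq p" using sigma_sq_one_mod3(1)[OF p(1)] by presburger
      then show False using sigma_sq_one_mod3(2)[OF p(1)] by blast
    next
      assume "\<exists>p\<in>R. 3 dvd sigma_sq p"
      then show False using sigma_sq_mod3 by (auto simp: dvd_eq_mod_eq_0)
    qed
  qed
  \<comment> \<open>Neither \<open>u * m\<close> nor \<open>X\<close> is divisible by 3, so
    \<open>eq_X\<close> equates the exponents 2 and \<open>card Q\<close>.\<close>
  have mult3: "multiplicity 3 (3 ^ i * y) = i" if "\<not> 3 dvd y" for i and y :: nat
    using that by (intro multiplicity_eqI) auto
  have "\<not> 3 dvd m" using m_mod_3(2) by presburger
  then have "\<not> 3 dvd u * m" using not_3_u by (simp add: prime_dvd_mult_iff)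
  then have "card Q = 2" using mult3[of "u * m" 2] mult3[OF \<open>\<not> 3 dvd X\<close>, of "card Q"] eq_X by simp
  then obtain x y where xy: "Q = {x, y}" "x \<noteq> y" by (meson card_2_iff)
  define q1 where "q1 = min x y"
  define q2 where "q2 = max x y"
  have Q: "Q = {q1, q2}" and less: "q1 < q2" using xy by (auto simp: q1_def q2_def min_def max_def)
  have prod_q: "(\<Prod>p\<in>Q. f p) = f q1 * f q2" for f :: "nat \<Rightarrow> nat"
    unfolding Q using less by simp
  have qs: "q1 \<in> Q" "q2 \<in> Q" unfolding Q by auto
  \<comment> \<open>All primes of \<open>u\<close> are 1 mod 3, so \<open>u\<close> is coprime to 2
    and to the primes in \<open>R\<close>, and must divide the remaining factor of
    \<open>2 * K\<close>.\<close>
  have u_dvd: "u dvd (q1 * q2)\<^sup>2"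
  proof -
    have u_mod: "l mod 3 = 1" if "prime l" "l dvd u" for l
      using prime_dvd_sigma[of l] that not_3_u by (auto simp: u)
    have "l \<noteq> 2" if "prime l" "l dvd u" for l using u_mod[OF that] by auto
    then have "coprime u 2"
      by (metis coprime_commute prime_imp_coprime two_is_prime_nat)
    moreover have "coprime u (\<Prod>p\<in>R. p\<^sup>2)"
    proof (rule prod_coprime_right)
      fix p assume p: "p \<in> R"
      then have "\<not> p dvd u" using u_mod[of p] P(1) by auto
      then have "coprime p u" using p P(1) by (intro prime_imp_coprime) auto
      then show "coprime u (p\<^sup>2)" by (simp add: coprime_commute)
    qed
    moreover have "u dvd (2 * (\<Prod>p\<in>R. p\<^sup>2)) * (q1 * q2)\<^sup>2"
    proof -
      have "(2 * (\<Prod>p\<in>R. p\<^sup>2)) * (q1 * q2)\<^sup>2 = 2 * K"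
        unfolding K_def prod_q by (simp add: power_mult_distrib)
      then show ?thesis unfolding sum_eq[symmetric] using dvd_triv_left by metis
    qed
    ultimately show ?thesis by (simp add: coprime_dvd_mult_right_iff)
  qed
  have "reduced_descartes q1 q2 m u R"
  proof unfold_locales
    show "prime q1" "prime q2" "q1 mod 3 = 1" "q2 mod 3 = 1" using qs by auto
    show "q1 < q2" "0 < m" "u dvd (q1 * q2)\<^sup>2" using less pos u_dvd by blast+
    show "finite R" by simp
    show "prime r" "odd r" if "r \<in> R" for r using that P by auto
    show "r mod 3 = 2" if "r \<in> R" for r using that by simp
    show "0 < u" using t_pos u by simp
    show "u * (m + 1) = 2 * ((q1 * q2)\<^sup>2 * (\<Prod>r\<in>R. r\<^sup>2))"
      unfolding sum_eq K_def prod_q by (simp add: power_mult_distrib)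
    show "u * m = 13 * (sigma_sq q1 div 3 * (sigma_sq q2 div 3)) * (\<Prod>r\<in>R. sigma_sq r)"
      using eq_X unfolding X_def prod_q \<open>card Q = 2\<close> by (simp add: mult_ac)
    show "l mod 3 = 1" if "l \<in> prime_factors m" for l using that by (rule m_mod_3(1))
    show "\<not> l ^ 3 dvd m" if "prime l" for l using that by (rule m_cube_free)
    show "card (prime_factors m) + card R = 4" using seven card_P \<open>card Q = 2\<close> by linarith
  qed
  then show False by (rule reduced_descartes.contradiction)
qed

end

section \<open>From Descartes numbers to the equations in \<open>k\<close>, \<open>m\<close>,
  \<open>t\<close>\<close>

text \<open>If \<open>t\<close> were even, 4 would divide \<open>t * (m + 1) = 2 * k\<close>. So
  \<open>t\<close> and \<open>sigma k\<close> are odd, and \<open>k\<close> is the square of a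
  squarefree number. The cube of a common prime of \<open>k\<close> and \<open>m\<close> would then
  divide \<open>n\<close>.\<close>

lemma descartes_sevenI:
  assumes "descartes_number n" "cube_free n" "card (prime_factors n) = 7"
  obtains k m t where "descartes_seven k m t"
proof -
  obtain k m where km: "odd n" "0 < k" "0 < m" "n = k * m" and eq: "sigma k * (m + 1) = 2 * k * m"
    using assms(1) unfolding descartes_number_def by blast
  have odd: "odd k" "odd m" using km by auto
  have "m dvd sigma k * (m + 1)" unfolding eq by simp
  moreover have "coprime m (m + 1)" by simp
  ultimately have "m dvd sigma k" by (simp add: coprime_dvd_mult_left_iff)
  then obtain t where t: "sigma k = m * t" by blast
  then have "m * (t * (m + 1)) = m * (2 * k)" using eq by (simp add: mult_ac)
  then have k_eq: "t * (m + 1) = 2 * k" using km by simp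
  have "odd t"
  proof
    assume "even t"
    then have "2 * 2 dvd t * (m + 1)" using odd by (intro mult_dvd_mono) auto
    then show False using odd(1) unfolding k_eq by simp
  qed
  then have "odd (sigma k)" using odd(2) t by simp
  have cf: "\<not> p ^ 3 dvd n" if "prime p" for p using assms(2) that by (auto simp: cube_free_def)
  have "cube_free k" using cf unfolding km(4) cube_free_def by (meson dvd_mult2)
  have k_sq: "k = (\<Prod>p\<in>prime_factors k. p\<^sup>2)"
    by (rule cube_free_odd_sigma[OF odd(1) \<open>cube_free k\<close> \<open>odd (sigma k)\<close>])
  have "coprime k m"
  proof (rule ccontr)
    assume "\<not> coprime k m"
    then have "gcd k m \<noteq> 1" using coprime_iff_gcd_eq_1 by blast
    then obtain p where "prime p" "p dvd gcd k m" using prime_factor_nat by blast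
    then have p: "prime p" "p dvd k" "p dvd m" by simp_all
    then have "p \<in> prime_factors k" using km by (simp add: in_prime_factors_iff)
    then have "p\<^sup>2 dvd k" using k_sq by (metis dvd_prodI finite_set_mset)
    then have "p\<^sup>2 * p dvd n" using p(3) km(4) by (simp add: mult_dvd_mono)
    then show False using cf[OF p(1)] by (simp add: power2_eq_square power3_eq_cube)
  qed
  have "prime_factors k \<inter> prime_factors m = {}"
    using \<open>coprime k m\<close> by (auto simp: in_prime_factors_iff dest: coprime_common_divisor_nat)
  moreover have "prime_factors n = prime_factors k \<union> prime_factors m"
    using km by (simp add: prime_factorization_mult)
  ultimately have "card (prime_factors k) + card (prime_factors m) = 7"
    using assms(3) by (simp add: card_Un_disjoint)
  then have "descartes_seven k m t"
    using km odd t k_eq k_sq \<open>coprime k m\<close> cf by unfold_locales (auto intro: dvd_mult)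
  then show ?thesis by (rule that)
qed

theorem theorem1:
  "\<not> (\<exists>n::nat. descartes_number n \<and> cube_free n \<and> card (prime_factors n) = 7)"
  using descartes_sevenI descartes_seven.contradiction by metis

end
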